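(* Suppose that $n$ is a positive odd integer and $m$ is a positive integer. Then $$\sum_{k=1}^n(-1)^kk^{2m}B_{2m+1}\left(\frac{n-k}{2}\right)=0,$$ where $B_j(x)$ denotes the Bernoulli polynomial of degree $j$.
   Context: The Bernoulli numbers $B_0,B_1,B_2,\ldots$ are given by $\frac{x}{e^x-1}=\sum_{k=0}^\infty B_k\frac{x^k}{k!}$ for $0<|x|<2\pi$, and the Bernoulli polynomial of degree $j$ is $B_j(x)=\sum_{i=0}^j\binom{j}{i}B_i\,x^{j-i}$. *)

theory Defs
  imports "HOL-Complex_Analysis.Complex_Analysis"
begin

text \<open>
  The Bernoulli numbers are the coefficients of the exponential generating function
  \<open>x / (exp x - 1)\<close>, taken as a quotient of formal power series. The lemma
  \<open>bernoulli_sums\<close> below shows that this series converges to the function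
  on the punctured disc of radius \<open>2 * pi\<close>. Here \<open>bernoulli 1 = - 1 / 2\<close>.
\<close>

definition bernoulli :: "nat \<Rightarrow> real" where
  "bernoulli k = fact k * fps_nth (fps_X / (fps_exp 1 - 1)) k"

definition bernoulli_poly :: "nat \<Rightarrow> real \<Rightarrow> real" where
  "bernoulli_poly j x = (\<Sum>i=0..j. real (j choose i) * bernoulli i * x ^ (j - i))"

lemma subdegree_exp_minus_1:
  "subdegree (fps_exp 1 - 1 :: 'a :: field_char_0 fps) = 1"
  by (rule subdegreeI) auto

lemma bernoulli_fps_complex:
  "Abs_fps (\<lambda>k. complex_of_real (bernoulli k) / fact k) = fps_X / (fps_exp 1 - 1)"
proof -
  let ?F = "fps_X / (fps_exp 1 - 1) :: real fps"
  let ?E = "fps_exp 1 - 1 :: real fps"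
  let ?C = "fps_exp 1 - 1 :: complex fps"
  have nz: "?E \<noteq> 0" "?C \<noteq> 0"
    using subdegree_exp_minus_1[where 'a = real] subdegree_exp_minus_1[where 'a = complex]
    by force+
  have "?E dvd fps_X"
    using nz by (simp add: fps_dvd_iff subdegree_exp_minus_1 del: subdegree_minus_commute)
  hence F: "?F * ?E = fps_X"
    by (rule dvd_div_mult_self)
  have "Abs_fps (\<lambda>k. complex_of_real (bernoulli k) / fact k) * ?C = fps_X"
  proof (rule fps_ext)
    fix n
    have C: "fps_nth ?C i = complex_of_real (fps_nth ?E i)" for i
      by simp
    have "fps_nth (Abs_fps (\<lambda>k. complex_of_real (bernoulli k) / fact k) * ?C) n =
            complex_of_real (fps_nth (?F * ?E) n)"
      unfolding fps_mult_nth C of_real_sum of_real_mult by (simp add: bernoulli_def)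
    also have "\<dots> = fps_nth fps_X n"
      unfolding F by simp
    finally show "fps_nth (Abs_fps (\<lambda>k. complex_of_real (bernoulli k) / fact k) * ?C) n =
        fps_nth fps_X n" .
  qed
  thus ?thesis
    using nonzero_mult_div_cancel_right[OF nz(2)] by metis
qed

lemma exp_neq_1:
  assumes "z \<noteq> 0" "norm z < 2 * pi"
  shows   "exp (z :: complex) \<noteq> 1"
proof
  assume "exp z = 1"
  then obtain n :: int where n: "Re z = 0" "Im z = of_int (2 * n) * pi"
    by (auto simp: exp_eq_1)
  with assms have "n \<noteq> 0" by (auto simp: complex_eq_iff)
  hence "\<bar>of_int n :: real\<bar> \<ge> 1" by linarith
  hence "2 * pi \<le> \<bar>Im z\<bar>" by (simp add: n abs_mult)
  also have "\<dots> \<le> norm z" by (rule abs_Im_le_cmod)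
  finally show False using assms by simp
qed

lemma bernoulli_sums:
  assumes "0 < norm z" "norm z < 2 * pi"
  shows   "(\<lambda>k. complex_of_real (bernoulli k) * z ^ k / fact k) sums (z / (exp z - 1))"
proof -
  let ?C = "fps_exp 1 - 1 :: complex fps"
  let ?f = "\<lambda>x. if x = 0 then 1 else x / (exp x - 1) :: complex"
  have C: "(\<lambda>x. exp x - 1) has_fps_expansion ?C"
    using has_fps_expansion_diff[OF has_fps_expansion_exp[of 1] has_fps_expansion_1] by simp
  have nz: "?C \<noteq> 0" using subdegree_exp_minus_1[where 'a = complex] by force
  have exp: "?f has_fps_expansion (fps_X / ?C)"
    by (rule has_fps_expansion_divide[OF has_fps_expansion_fps_X C])
       (use nz in \<open>simp_all add: subdegree_exp_minus_1 del: subdegree_minus_commute\<close>)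
  have ball: "eball 0 (ereal (2 * pi)) = ball (0 :: complex) (2 * pi)"
    by auto
  have "continuous (at 0) ?f"
    using exp by (rule has_fps_expansion_imp_continuous)
  hence lim: "?f \<midarrow>0\<rightarrow> ?f 0"
    by (simp only: continuous_at)
  have hol: "?f holomorphic_on ball 0 (2 * pi) - {0}"
  proof -
    have "(\<lambda>x. x / (exp x - 1)) holomorphic_on ball 0 (2 * pi) - {0 :: complex}"
      by (intro holomorphic_intros) (use exp_neq_1 in auto)
    thus ?thesis by (rule holomorphic_transform) auto
  qed
  have "?f holomorphic_on ball 0 (2 * pi)"
  proof (rule no_isolated_singularity'[of "{0}"])
    show "(?f \<longlongrightarrow> ?f z) (at z within ball 0 (2 * pi))" if "z \<in> {0}" for z
      using that tendsto_within_subset[OF lim subset_UNIV] by blast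
  qed (use hol in simp_all)
  hence "(\<lambda>k. fps_nth (fps_X / ?C) k * z ^ k) sums ?f z"
    using exp assms by (intro has_fps_expansion_imp_sums_complex[where r = "2 * pi"]) (auto simp: ball)
  thus ?thesis
    using assms unfolding bernoulli_fps_complex [symmetric] by simp
qed

corollary bernoulli_sums_real:
  fixes x :: real
  assumes "0 < \<bar>x\<bar>" "\<bar>x\<bar> < 2 * pi"
  shows   "(\<lambda>k. bernoulli k * x ^ k / fact k) sums (x / (exp x - 1))"
proof -
  have "(\<lambda>k. complex_of_real (bernoulli k * x ^ k / fact k)) sums complex_of_real (x / (exp x - 1))"
    using bernoulli_sums[of "complex_of_real x"] assms by (simp add: exp_of_real)
  thus ?thesis by (simp only: sums_of_real_iff)
qed

end

theory Submission
  imports Defs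
begin

text \<open>
  The difference equation \<open>B\<^sub>j(x+1) - B\<^sub>j(x) = j x\<^sup>j\<^sup>-\<^sup>1\<close>, together with the vanishing of
  \<open>B\<^sub>2\<^sub>m\<^sub>+\<^sub>1\<close> at \<open>0\<close> and \<open>1/2\<close>, expresses \<open>B\<^sub>2\<^sub>m\<^sub>+\<^sub>1(N/2)\<close> as a multiple of the sum of
  \<open>i\<^sup>2\<^sup>m\<close> over the \<open>i < N\<close> with the parity of \<open>N\<close>. The sum in question thus becomes a multiple of
  the sum of \<open>(-1)\<^sup>k k\<^sup>2\<^sup>m i\<^sup>2\<^sup>m\<close> over all pairs \<open>(k, i)\<close> with \<open>k + i < n\<close> and \<open>k + i\<close> odd.
  Since \<open>k\<close> and \<open>i\<close> have opposite parities, exchanging them changes the sign.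
\<close>

definition bernoulli_fps :: "real fps" where
  "bernoulli_fps = fps_X / (fps_exp 1 - 1)"

lemma fps_exp_minus_1_nonzero: "fps_exp 1 - 1 \<noteq> (0 :: 'a :: field_char_0 fps)"
  using subdegree_exp_minus_1[where 'a = 'a] by force

lemma bernoulli_fps_mult_exp: "bernoulli_fps * (fps_exp 1 - 1) = fps_X"
proof -
  have "(fps_exp 1 - 1 :: real fps) dvd fps_X"
    using fps_exp_minus_1_nonzero[where 'a = real]
    by (simp add: fps_dvd_iff subdegree_exp_minus_1 del: subdegree_minus_commute)
  thus ?thesis
    unfolding bernoulli_fps_def by (rule dvd_div_mult_self)
qed

lemma bernoulli_poly_egf: "fps_nth (bernoulli_fps * fps_exp x) j = bernoulli_poly j x / fact j"
  unfolding fps_mult_nth bernoulli_poly_def sum_divide_distrib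
  by (intro sum.cong refl) (simp add: bernoulli_fps_def bernoulli_def binomial_fact)

text \<open>Replacing \<open>x\<close> by \<open>x + 1\<close> multiplies the generating function by
  \<open>fps_exp 1\<close>, so the difference cancels the denominator and leaves
  \<open>fps_X * fps_exp x\<close>.\<close>

lemma bernoulli_poly_plus_1:
  "bernoulli_poly (Suc j) (x + 1) = bernoulli_poly (Suc j) x + real (Suc j) * x ^ j"
proof -
  have "bernoulli_fps * fps_exp (x + 1) - bernoulli_fps * fps_exp x =
          bernoulli_fps * (fps_exp 1 - 1) * fps_exp x"
    by (simp add: fps_exp_add_mult algebra_simps)
  also have "\<dots> = fps_X * fps_exp x"
    by (simp only: bernoulli_fps_mult_exp)
  finally have "fps_nth (bernoulli_fps * fps_exp (x + 1) - bernoulli_fps * fps_exp x) (Suc j) =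
      x ^ j / fact j"
    by simp
  hence "(bernoulli_poly (Suc j) (x + 1) - bernoulli_poly (Suc j) x) / fact (Suc j) = x ^ j / fact j"
    by (simp only: fps_sub_nth bernoulli_poly_egf diff_divide_distrib)
  also have "x ^ j / fact j = real (Suc j) * x ^ j / fact (Suc j)"
    unfolding fact_Suc by (rule mult_divide_mult_cancel_left[symmetric]) simp
  finally have "bernoulli_poly (Suc j) (x + 1) - bernoulli_poly (Suc j) x = real (Suc j) * x ^ j"
    by (simp only: divide_cancel_right fact_nonzero simp_thms)
  thus ?thesis
    by linarith
qed

text \<open>This is -t/(e^(-t) - 1) = t e^t/(e^t - 1), obtained by clearing denominators and
  cancelling the nonzero series \<open>fps_exp 1 - 1\<close>.\<close>

lemma bernoulli_fps_compose_uminus: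
  "bernoulli_fps oo - fps_X = bernoulli_fps * fps_exp 1"
proof -
  let ?E = "fps_exp 1 :: real fps"
  let ?G = "bernoulli_fps oo - fps_X"
  have inv: "fps_exp (- 1) * ?E = 1"
    by (simp flip: fps_exp_add_mult)
  have "?G * (fps_exp (- 1) - 1) = (bernoulli_fps * (?E - 1)) oo - fps_X"
    by (simp add: fps_compose_mult_distrib fps_compose_sub_distrib fps_compose_uminus)
  also have "\<dots> = - fps_X"
    by (simp add: bernoulli_fps_mult_exp)
  finally have "?G * (fps_exp (- 1) - 1) * ?E = - fps_X * ?E"
    by simp
  moreover have "?G * (fps_exp (- 1) - 1) * ?E = ?G * (fps_exp (- 1) * ?E - ?E)"
    by (simp add: algebra_simps)
  ultimately have "?G * (1 - ?E) = - fps_X * ?E"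
    by (simp only: inv)
  hence "?G * (?E - 1) = fps_X * ?E"
    by (simp add: algebra_simps)
  also have "\<dots> = bernoulli_fps * ?E * (?E - 1)"
    unfolding bernoulli_fps_mult_exp[symmetric] by (simp only: mult_ac)
  finally show ?thesis
    using fps_exp_minus_1_nonzero by simp
qed

text \<open>Substituting -t for t turns t e^(xt)/(e^t - 1) into t e^((1-x)t)/(e^t - 1) and
  multiplies the coefficient of index \<open>j\<close> by \<open>(- 1) ^ j\<close>.\<close>

lemma bernoulli_poly_reflect: "bernoulli_poly j (1 - x) = (- 1) ^ j * bernoulli_poly j x"
proof -
  have "(bernoulli_fps * fps_exp x) oo - fps_X = bernoulli_fps * (fps_exp 1 * fps_exp (- x))"
    by (simp add: fps_compose_mult_distrib bernoulli_fps_compose_uminus mult.assoc)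
  also have "\<dots> = bernoulli_fps * fps_exp (1 - x)"
    by (simp flip: fps_exp_add_mult)
  finally have "fps_nth ((bernoulli_fps * fps_exp x) oo - fps_X) j = bernoulli_poly j (1 - x) / fact j"
    by (simp only: bernoulli_poly_egf)
  thus ?thesis
    by (simp only: fps_compose_uminus' fps_nth_Abs_fps bernoulli_poly_egf) simp
qed

lemma bernoulli_poly_odd_half: "odd j \<Longrightarrow> bernoulli_poly j (1 / 2) = 0"
  using bernoulli_poly_reflect[of j "1 / 2"] by simp

text \<open>Reflection makes the values at 0 and 1 opposite, while the difference equation makes
  them equal because \<open>0 ^ (2 * m) = 0\<close>.\<close>

lemma bernoulli_poly_odd_0:
  assumes "m > 0"
  shows "bernoulli_poly (2 * m + 1) 0 = 0"
proof -
  have "bernoulli_poly (2 * m + 1) 1 = - bernoulli_poly (2 * m + 1) 0"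
    using bernoulli_poly_reflect[of "2 * m + 1" 0] by simp
  moreover have "bernoulli_poly (2 * m + 1) 1 = bernoulli_poly (2 * m + 1) 0"
    using bernoulli_poly_plus_1[of "2 * m" 0] assms by (simp add: power_0_left)
  ultimately show ?thesis
    by linarith
qed

text \<open>Induction in steps of two, since the difference equation moves \<open>N / 2\<close> by
  1; the base cases are the zeros at 0 and 1/2.\<close>

lemma bernoulli_poly_odd_half_nat:
  assumes "m > 0"
  shows "bernoulli_poly (2 * m + 1) (real N / 2) =
           real (2 * m + 1) * (\<Sum>i<N. if even (N + i) then (real i / 2) ^ (2 * m) else 0)"
proof (induction N rule: induct_nat_012)
  case 0
  show ?case using bernoulli_poly_odd_0[OF assms] by simp
next
  case 1
  show ?case using bernoulli_poly_odd_half[of "2 * m + 1"] by simp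
next
  case (ge2 N)
  have "real (Suc (Suc N)) / 2 = real N / 2 + 1"
    by simp
  hence "bernoulli_poly (2 * m + 1) (real (Suc (Suc N)) / 2) =
      bernoulli_poly (2 * m + 1) (real N / 2) + real (2 * m + 1) * (real N / 2) ^ (2 * m)"
    by (simp only: bernoulli_poly_plus_1 flip: Suc_eq_plus1)
  also have "\<dots> = real (2 * m + 1) *
      ((\<Sum>i<N. if even (N + i) then (real i / 2) ^ (2 * m) else 0) + (real N / 2) ^ (2 * m))"
    by (simp only: ge2.IH(1) distrib_left)
  \<comment> \<open>Of the two new indices, \<open>N\<close> has the right parity and
    \<open>Suc N\<close> the wrong one.\<close>
  also have "(\<Sum>i<N. if even (N + i) then (real i / 2) ^ (2 * m) else 0) + (real N / 2) ^ (2 * m) =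
      (\<Sum>i<Suc (Suc N). if even (Suc (Suc N) + i) then (real i / 2) ^ (2 * m) else 0)"
    by simp
  finally show ?case .
qed

theorem corollary1:
  fixes n m :: nat
  assumes "odd n" and "m > 0"
  shows "(\<Sum>k=1..n. (-1) ^ k * real k ^ (2 * m) *
            bernoulli_poly (2 * m + 1) ((real n - real k) / 2)) = 0"
proof -
  define c where "c = real (2 * m + 1) / 2 ^ (2 * m)"
  define g where "g k i = (if k + i < n \<and> odd (k + i)
    then (-1) ^ k * real k ^ (2 * m) * real i ^ (2 * m) else 0)" for k i
  \<comment> \<open>When \<open>k + i\<close> is odd, \<open>(-1) ^ k\<close> and
    \<open>(-1) ^ i\<close> are opposite.\<close>
  have anti: "g k i = - g i k" for k i
    by (auto simp: g_def add.commute minus_one_power_iff)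
  have "(\<Sum>k<n. \<Sum>i<n. g k i) = (\<Sum>i<n. \<Sum>k<n. g k i)"
    by (rule sum.swap)
  also have "\<dots> = - (\<Sum>i<n. \<Sum>k<n. g i k)"
    by (subst anti) (simp add: sum_negf)
  finally have zero: "(\<Sum>k<n. \<Sum>i<n. g k i) = 0"
    by simp
  have summand: "(-1) ^ k * real k ^ (2 * m) * bernoulli_poly (2 * m + 1) ((real n - real k) / 2) =
      c * (\<Sum>i<n. g k i)" if "k \<le> n" for k
  proof -
    have "bernoulli_poly (2 * m + 1) ((real n - real k) / 2) = real (2 * m + 1) *
        (\<Sum>i<n - k. if even (n - k + i) then (real i / 2) ^ (2 * m) else 0)"
      using bernoulli_poly_odd_half_nat[OF assms(2), of "n - k"] by (simp only: of_nat_diff[OF that])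
    \<comment> \<open>As \<open>n\<close> is odd, \<open>n - k + i\<close> is even exactly when
      \<open>k + i\<close> is odd.\<close>
    also have "(\<Sum>i<n - k. if even (n - k + i) then (real i / 2) ^ (2 * m) else 0) =
        (\<Sum>i<n. if k + i < n \<and> odd (k + i) then (real i / 2) ^ (2 * m) else 0)"
      by (rule sum.mono_neutral_cong_left) (use that assms(1) in auto)
    finally show ?thesis
      unfolding c_def g_def by (simp only: sum_distrib_left) (intro sum.cong refl, simp add: power_divide)
  qed
  have "(\<Sum>k=1..n. (-1) ^ k * real k ^ (2 * m) *
            bernoulli_poly (2 * m + 1) ((real n - real k) / 2)) = (\<Sum>k=1..n. c * (\<Sum>i<n. g k i))"
    by (intro sum.cong refl summand) simp
  \<comment> \<open>The ranges differ in \<open>k = n\<close>, where no \<open>i\<close> satisfies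
    \<open>k + i < n\<close>, and in \<open>k = 0\<close>, where \<open>m > 0\<close> makes the
    power of \<open>k\<close> vanish.\<close>
  also have "\<dots> = (\<Sum>k<n. c * (\<Sum>i<n. g k i))"
    by (rule sum.mono_neutral_cong) (use assms(2) in \<open>auto simp: g_def not_le intro!: sum.neutral\<close>)
  also have "\<dots> = 0"
    unfolding sum_distrib_left[symmetric] zero by simp
  finally show ?thesis .
qed

end
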